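(* Let $X$ and $Y$ be random variables with distributions $F$ and $G$ respectively, where $F$ has as support the whole real axis and $G(0-)=0$, $G(0)<1$. Let $H$ be the distribution of $XY$. Suppose that (A) for any $c>0$, $\overline{G}(cx)=o[\overline{H}(x)]$ as $x\to\infty$; (B) there exists a function $h:[0,\infty)\to(0,\infty)$ such that $\mathbf{P}[X>x\mid Y=y]\sim h(y)\,\mathbf{P}[X>x]$ as $x\to\infty$, uniformly for $y\in S_Y$. Then: (1) if $F\in\mathcal{D}$, then $H\in\mathcal{D}$; (2) if $F\in\mathcal{D}\cap\mathcal{L}$, then $H\in\mathcal{D}\cap\mathcal{L}$; (3) if $F\in\mathcal{C}$, then $H\in\mathcal{C}$; (4) if $F\in\mathcal{K}$, then $H\in\mathcal{K}$.
   Context: For a distribution $F$ write $\overline{F}:=1-F$; throughout $\overline{F}(x)>0$ for all $x\ge 0$. $H(x):=\mathbf{P}[XY\le x]$. $S_Y$ is the support of $Y$. Uniformity in (B) means $\lim_{x\to\infty}\sup_{y\in S_Y}\left|\frac{\mathbf{P}[X>x\mid Y=y]}{h(y)\mathbf{P}[X>x]}-1\right|=0$. Classes of distributions: - $F\in\mathcal{D}$ (dominatedly varying) if for all (equivalently, for some) $b\in(0,1)$, $\limsup_{x\to\infty}\overline{F}(bx)/\overline{F}(x)<\infty$. - $F\in\mathcal{L}$ (long tailed) if for all (equivalently, for some) $a>0$, $\lim_{x\to\infty}\overline{F}(x-a)/\overline{F}(x)=1$. - $F\in\mathcal{C}$ (consistently varying) if $\lim_{b\uparrow 1}\limsup_{x\to\infty}\overline{F}(bx)/\overline{F}(x)=1$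 (equivalently $\lim_{v\downarrow 1}\liminf_{x\to\infty}\overline{F}(vx)/\overline{F}(x)=1$). - $F\in\mathcal{K}$ (heavy tailed) if $\int_{-\infty}^\infty e^{\varepsilon y}F(dy)=\infty$ for all $\varepsilon>0$. *)

theory Defs
  imports "HOL-Probability.Probability" "HOL-Library.Landau_Symbols"
begin

definition tail :: "real measure \<Rightarrow> real \<Rightarrow> real" where
  "tail F x = 1 - cdf F x"

definition measure_support :: "real measure \<Rightarrow> real set" where
  "measure_support F = {x. \<forall>U. open U \<and> x \<in> U \<longrightarrow> emeasure F U > 0}"

(* The distribution classes below only contain distributions with unbounded right tail. This also
   keeps the tail ratios away from division by zero. *)
definition tailed_distributions :: "real measure set" where
  "tailed_distributions = {F. real_distribution F \<and> (\<forall>x\<ge>0. tail F x > 0)}"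

definition dominatedly_varying :: "real measure set" where
  "dominatedly_varying = {F \<in> tailed_distributions.
     \<forall>b. 0 < b \<and> b < 1 \<longrightarrow> Limsup at_top (\<lambda>x. ereal (tail F (b * x) / tail F x)) < \<infinity>}"

definition long_tailed :: "real measure set" where
  "long_tailed = {F \<in> tailed_distributions.
     \<forall>a>0. ((\<lambda>x. tail F (x - a) / tail F x) \<longlongrightarrow> 1) at_top}"

definition consistently_varying :: "real measure set" where
  "consistently_varying = {F \<in> tailed_distributions.
     ((\<lambda>b. Limsup at_top (\<lambda>x. ereal (tail F (b * x) / tail F x))) \<longlongrightarrow> 1) (at_left 1)}"

definition heavy_tailed :: "real measure set" where
  "heavy_tailed = {F \<in> tailed_distributions.
     \<forall>\<epsilon>>0. (\<integral>\<^sup>+ y. ennreal (exp (\<epsilon> * y)) \<partial>F) = \<infinity>}"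

(* \<kappa> is a version of the regular conditional distribution of X given Y, i.e.
   \<kappa> y A = P[X \<in> A | Y = y]. The events {Y = y} may be null, so the conditional probabilities are
   those of a probability kernel that disintegrates the joint law over the law of Y. *)
definition regular_cond_distr ::
  "'a measure \<Rightarrow> ('a \<Rightarrow> real) \<Rightarrow> ('a \<Rightarrow> real) \<Rightarrow> (real \<Rightarrow> real measure) \<Rightarrow> bool" where
  "regular_cond_distr M X Y \<kappa> \<longleftrightarrow>
     \<kappa> \<in> borel \<rightarrow>\<^sub>M prob_algebra borel \<and>
     (\<forall>A\<in>sets borel. \<forall>B\<in>sets borel.
        emeasure M {\<omega> \<in> space M. X \<omega> \<in> A \<and> Y \<omega> \<in> B} =
        (\<integral>\<^sup>+ y \<in> B. emeasure (\<kappa> y) A \<partial>distr M borel Y))"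

end

theory Submission
  imports Defs
begin

text \<open>
  For \<open>x \<ge> 0\<close> the tail of \<open>X * Y\<close> at \<open>x\<close> is the integral of \<open>P[X > x / y | Y = y]\<close> over \<open>y > 0\<close> with
  respect to the law of \<open>Y\<close> (\<open>prob_product_gt_eq_integral\<close>). By the uniform equivalence, beyond a
  threshold \<open>x0\<close> common to almost all \<open>y\<close>, the conditional tails at levels \<open>u\<close> and \<open>v\<close> have the same
  ratio as the tails of \<open>F\<close> at \<open>u\<close> and \<open>v\<close>, up to a factor \<open>R\<close> that can be taken arbitrarily close to
  \<open>1\<close>. The values \<open>y\<close> for which \<open>x / y\<close> stays below the threshold lie in an event \<open>Y > x / x1\<close>, which is
  negligible against the tail of \<open>H\<close> by hypothesis. Thus an
  estimate of the tail of \<open>F\<close> at \<open>x' / y\<close> by its tail at \<open>x / y\<close>, uniform in the remaining \<open>y\<close>, integrates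
  to an estimate of the tail of \<open>H\<close> at \<open>x'\<close> by its tail at \<open>x\<close> (\<open>prob_product_shift_le\<close>).

  For dominated and consistent variation \<open>x' = b * x\<close>, and the comparison for \<open>F\<close> does not depend on
  \<open>y\<close> (\<open>tail_H_scale_le\<close>). For long tails \<open>x' = x - a\<close>, and the shift in the argument of \<open>F\<close> is
  \<open>a / y\<close>. It is bounded when \<open>Y > \<eta>\<close> (\<open>prob_shifted_product_large_factor_le\<close>). The contribution of
  \<open>0 < Y \<le> \<eta>\<close> is at most a multiple of \<open>P(0 < Y \<le> \<eta>) * tail F (x / \<eta>)\<close>, by dominated variation, while the
  tail of \<open>H\<close> at \<open>x\<close> is at least \<open>c * tail F (x / \<eta>)\<close> with \<open>c > 0\<close> independent of small \<open>\<eta>\<close>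
  (\<open>tail_H_lower_bound\<close>); so it is negligible once \<open>\<eta>\<close> is small.

  The same lower bound settles heavy tails, because a distribution is heavy tailed exactly when
  \<open>exp (\<epsilon> * x) * tail F x\<close> is unbounded as \<open>x\<close> grows, for every \<open>\<epsilon> > 0\<close>.
\<close>

section \<open>Tails and supports of distributions on the line\<close>

lemma measure_greaterThan_eq_tail:
  assumes "real_distribution F"
  shows "measure F {x<..} = tail F x"
proof -
  interpret real_distribution F by fact
  show ?thesis
    using prob_compl[of "{..x}"] by (simp add: Compl_eq_Diff_UNIV[symmetric] tail_def cdf_def)
qed

lemma emeasure_greaterThan_eq_tail:
  assumes "real_distribution F"
  shows "emeasure F {x<..} = ennreal (tail F x)"
proof -
  interpret real_distribution F by fact
  show ?thesis by (simp add: emeasure_eq_measure measure_greaterThan_eq_tail assms)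
qed

lemma (in prob_space) tail_distr:
  assumes [measurable]: "Z \<in> borel_measurable M"
  shows "tail (distr M borel Z) x = prob {\<omega> \<in> space M. x < Z \<omega>}"
proof -
  have "tail (distr M borel Z) x = measure (distr M borel Z) {x<..}"
    by (rule measure_greaterThan_eq_tail[symmetric]) simp
  also have "\<dots> = prob {\<omega> \<in> space M. x < Z \<omega>}"
    by (subst measure_distr) (auto intro!: arg_cong[where f = prob])
  finally show ?thesis .
qed

lemma tail_antimono:
  assumes "real_distribution F" "x \<le> y"
  shows "tail F y \<le> tail F x"
proof -
  interpret real_distribution F by fact
  show ?thesis using cdf_nondecreasing[OF \<open>x \<le> y\<close>] by (simp add: tail_def)
qed

lemma tail_le_1: "tail F x \<le> 1"
  by (simp add: tail_def cdf_def)

text \<open>The complement of the support is a union of null open sets; a countable topological basis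
  makes this union countable, hence null.\<close>

lemma AE_measure_support:
  assumes "sets G = sets borel"
  shows "AE y in G. y \<in> measure_support G"
proof -
  obtain B :: "real set set" where B: "countable B" "topological_basis B"
    using ex_countable_basis by blast
  define N where "N = \<Union> {U \<in> B. emeasure G U = 0}"
  have "N \<in> null_sets G"
  proof -
    have "(\<Union>U\<in>{U \<in> B. emeasure G U = 0}. U) \<in> null_sets G"
      using B assms topological_basis_open[OF B(2)]
      by (intro null_sets_UN') (auto simp: null_sets_def)
    then show ?thesis by (simp add: N_def)
  qed
  moreover have "y \<in> N" if y: "y \<notin> measure_support G" for y
  proof -
    obtain U where U: "open U" "y \<in> U" "emeasure G U = 0"
      using y by (auto simp: measure_support_def not_gr_zero)
    obtain V where V: "V \<in> B" "y \<in> V" "V \<subseteq> U"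
      using topological_basisE[OF B(2) U(1,2)] by blast
    have "emeasure G V \<le> emeasure G U"
      using V(3) U(1) assms by (intro emeasure_mono) auto
    with U V show ?thesis by (auto simp: N_def)
  qed
  ultimately show ?thesis by (intro AE_I'[of N]) auto
qed

section \<open>Disintegration of the joint law\<close>

lemma regular_cond_distr_kernel:
  assumes "regular_cond_distr M X Y \<kappa>"
  shows "prob_space (\<kappa> y)" "sets (\<kappa> y) = sets borel"
  using assms measurable_space[of \<kappa> borel "prob_algebra borel" y]
  by (auto simp: regular_cond_distr_def space_prob_algebra)

text \<open>A regular conditional distribution is specified on rectangles only, whereas the event
  \<open>X * Y > x\<close> is not a rectangle. Both sides of the specification are values of measures on the plane,
  the law of \<open>(X, Y)\<close> and the law obtained by drawing \<open>y\<close> first and then \<open>x\<close> from \<open>\<kappa> y\<close>. Rectangles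
  are stable under intersection and generate the product \<open>\<sigma>\<close>-algebra, so these measures coincide.\<close>

lemma regular_cond_distr_disintegration:
  assumes "prob_space M"
    and X[measurable]: "X \<in> borel_measurable M" and Y[measurable]: "Y \<in> borel_measurable M"
    and cond: "regular_cond_distr M X Y \<kappa>"
    and S: "S \<in> sets (borel \<Otimes>\<^sub>M borel)"
  shows "emeasure M {\<omega> \<in> space M. (X \<omega>, Y \<omega>) \<in> S} =
         (\<integral>\<^sup>+ y. emeasure (\<kappa> y) {x. (x, y) \<in> S} \<partial>distr M borel Y)"
proof -
  interpret prob_space M by fact
  let ?B2 = "borel \<Otimes>\<^sub>M borel :: (real \<times> real) measure"
  define G where "G = distr M borel Y"
  have [measurable]: "\<kappa> \<in> borel \<rightarrow>\<^sub>M prob_algebra borel"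
    and rect: "\<And>A B. A \<in> sets borel \<Longrightarrow> B \<in> sets borel \<Longrightarrow>
        emeasure M {\<omega> \<in> space M. X \<omega> \<in> A \<and> Y \<omega> \<in> B} = (\<integral>\<^sup>+ y \<in> B. emeasure (\<kappa> y) A \<partial>G)"
    using cond by (auto simp: regular_cond_distr_def G_def)
  have [measurable_cong]: "sets G = sets borel" by (simp add: G_def)
  have ksub[measurable]: "\<kappa> \<in> borel \<rightarrow>\<^sub>M subprob_algebra borel"
    by (rule measurable_prob_algebraD) measurable
  note ksets = regular_cond_distr_kernel(2)[OF cond]
  have kspace: "space (\<kappa> y) = UNIV" for y
    using sets_eq_imp_space_eq[OF ksets] by simp
  define K where "K y = distr (\<kappa> y) ?B2 (\<lambda>x. (x, y))" for y
  have K_meas: "K \<in> G \<rightarrow>\<^sub>M subprob_algebra ?B2"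
  proof -
    have "(\<lambda>y. distr (\<kappa> y) ?B2 (\<lambda>x. (x, y))) \<in> borel \<rightarrow>\<^sub>M subprob_algebra ?B2"
      by (rule measurable_distr2[where M = borel]) measurable
    then show ?thesis by (simp add: K_def[abs_def] cong: measurable_cong_sets)
  qed
  have pair_meas: "(\<lambda>x. (x, y)) \<in> \<kappa> y \<rightarrow>\<^sub>M ?B2" for y
    by (simp add: measurable_Pair1' cong: measurable_cong_sets[OF ksets])
  have bind: "emeasure (G \<bind> K) T = (\<integral>\<^sup>+ y. emeasure (\<kappa> y) {x. (x, y) \<in> T} \<partial>G)"
    if "T \<in> sets ?B2" for T
  proof -
    have "emeasure (G \<bind> K) T = (\<integral>\<^sup>+ y. emeasure (K y) T \<partial>G)"
      by (rule emeasure_bind[OF _ K_meas that]) (simp add: G_def)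
    also have "\<dots> = (\<integral>\<^sup>+ y. emeasure (\<kappa> y) {x. (x, y) \<in> T} \<partial>G)"
      using that by (intro nn_integral_cong)
        (simp add: K_def emeasure_distr[OF pair_meas] kspace vimage_def)
    finally show ?thesis .
  qed
  have "distr M ?B2 (\<lambda>\<omega>. (X \<omega>, Y \<omega>)) = G \<bind> K"
  proof (rule measure_eqI_generator_eq[where \<Omega> = UNIV and A = "\<lambda>_. UNIV"
        and E = "{a \<times> b | a b. a \<in> sets (borel :: real measure) \<and> b \<in> sets (borel :: real measure)}"])
    show "Int_stable {a \<times> b | a b. a \<in> sets (borel :: real measure) \<and> b \<in> sets (borel :: real measure)}"
      by (rule Int_stable_pair_measure_generator)
    show "sets (distr M ?B2 (\<lambda>\<omega>. (X \<omega>, Y \<omega>))) = sigma_sets UNIV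
        {a \<times> b | a b. a \<in> sets (borel :: real measure) \<and> b \<in> sets (borel :: real measure)}"
      by (simp add: sets_pair_measure)
    show "sets (G \<bind> K) = sigma_sets UNIV
        {a \<times> b | a b. a \<in> sets (borel :: real measure) \<and> b \<in> sets (borel :: real measure)}"
      by (subst sets_bind[where N = ?B2]) (simp_all add: K_def G_def sets_pair_measure)
    fix T assume "T \<in> {a \<times> b | a b. a \<in> sets (borel :: real measure) \<and> b \<in> sets (borel :: real measure)}"
    then obtain A C where T: "T = A \<times> C" and [measurable]: "A \<in> sets borel" "C \<in> sets borel"
      by blast
    have "emeasure (distr M ?B2 (\<lambda>\<omega>. (X \<omega>, Y \<omega>))) T
        = emeasure M {\<omega> \<in> space M. X \<omega> \<in> A \<and> Y \<omega> \<in> C}"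
      unfolding T by (subst emeasure_distr) (auto intro!: arg_cong[where f = "emeasure M"])
    also have "\<dots> = (\<integral>\<^sup>+ y \<in> C. emeasure (\<kappa> y) A \<partial>G)"
      by (rule rect) measurable
    also have "\<dots> = (\<integral>\<^sup>+ y. emeasure (\<kappa> y) {x. (x, y) \<in> T} \<partial>G)"
      by (intro nn_integral_cong) (auto simp: T split: split_indicator)
    also have "\<dots> = emeasure (G \<bind> K) T"
      by (rule bind[symmetric]) (simp add: T)
    finally show "emeasure (distr M ?B2 (\<lambda>\<omega>. (X \<omega>, Y \<omega>))) T = emeasure (G \<bind> K) T" .
  next
    show "emeasure (distr M ?B2 (\<lambda>\<omega>. (X \<omega>, Y \<omega>))) UNIV \<noteq> \<infinity>"
      using finite_measure.emeasure_finite[OF prob_space.finite_measure[OF prob_space_distr[of "\<lambda>\<omega>. (X \<omega>, Y \<omega>)" ?B2]]]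
      by simp
  qed (auto intro!: exI[of _ UNIV])
  then have "emeasure (distr M ?B2 (\<lambda>\<omega>. (X \<omega>, Y \<omega>))) S
      = (\<integral>\<^sup>+ y. emeasure (\<kappa> y) {x. (x, y) \<in> S} \<partial>G)"
    using bind[OF S] by simp
  then show ?thesis
    using S by (simp add: emeasure_distr G_def vimage_def Int_def conj_commute)
qed

section \<open>Heavy tails and exponential growth\<close>

text \<open>Together with its converse below, this expresses heavy-tailedness through the
  tail function alone, so that it can be transferred by a pointwise comparison of tails. If
  \<open>exp (\<epsilon> * x) * tail F x\<close> stayed bounded, then bounding \<open>exp (d * y)\<close> on the intervals
  \<open>(n, n + 1]\<close> by its value at \<open>n + 1\<close> would dominate the exponential moment of order
  \<open>d = \<epsilon> / 2\<close> by a convergent geometric series.\<close>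

lemma heavy_tailed_exp_times_tail_unbounded:
  assumes F: "F \<in> heavy_tailed" and "0 < \<epsilon>"
  shows "\<exists>x\<ge>x1. K < exp (\<epsilon> * x) * tail F x"
proof (rule ccontr)
  assume "\<not> ?thesis"
  then have K: "exp (\<epsilon> * x) * tail F x \<le> K" if "x1 \<le> x" for x
    using that by (meson not_le)
  have F': "real_distribution F" and inf: "\<And>\<epsilon>. 0 < \<epsilon> \<Longrightarrow> (\<integral>\<^sup>+ y. ennreal (exp (\<epsilon> * y)) \<partial>F) = \<infinity>"
    using F by (auto simp: heavy_tailed_def tailed_distributions_def)
  interpret real_distribution F by fact
  have tail_nn: "0 \<le> tail F x" for x by (simp add: tail_def cdf_bounded_prob)
  \<comment> \<open>Below \<open>x1\<close> the tail is at most \<open>1\<close>, so the bound extends to all of the real line.\<close>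
  define C where "C = max K (exp (\<epsilon> * x1))"
  have C: "exp (\<epsilon> * x) * tail F x \<le> C" for x
  proof (cases "x1 \<le> x")
    case True then show ?thesis using K by (simp add: C_def le_max_iff_disj)
  next
    case False
    then have "exp (\<epsilon> * x) * tail F x \<le> exp (\<epsilon> * x1) * 1"
      using \<open>0 < \<epsilon>\<close> by (intro mult_mono) (auto simp: tail_le_1 tail_nn)
    then show ?thesis by (simp add: C_def)
  qed
  define d where "d = \<epsilon> / 2"
  have d: "0 < d" "\<epsilon> = d + d" using \<open>0 < \<epsilon>\<close> by (auto simp: d_def)
  have "(\<integral>\<^sup>+ y. ennreal (exp (d * y)) \<partial>F)
      \<le> (\<integral>\<^sup>+ y. 1 + (\<Sum>n. ennreal (exp (d * (real n + 1))) * indicator {real n<..} y) \<partial>F)"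
  proof (rule nn_integral_mono)
    fix y :: real
    show "ennreal (exp (d * y)) \<le> 1 + (\<Sum>n. ennreal (exp (d * (real n + 1))) * indicator {real n<..} y)"
    proof (cases "y \<le> 0")
      case True
      then have "exp (d * y) \<le> 1" using d by (simp add: mult_nonneg_nonpos)
      then have "ennreal (exp (d * y)) \<le> 1" using ennreal_leI by fastforce
      then show ?thesis by (simp add: add_increasing2)
    next
      case False
      define n where "n = nat (\<lceil>y\<rceil> - 1)"
      have n: "real n < y" "y \<le> real n + 1" using False by (auto simp: n_def) linarith+
      have "ennreal (exp (d * y)) \<le> ennreal (exp (d * (real n + 1))) * indicator {real n<..} y"
        using n d by (simp add: ennreal_leI)
      also have "\<dots> \<le> (\<Sum>n. ennreal (exp (d * (real n + 1))) * indicator {real n<..} y)"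
        using ennreal_suminf_lessD leI by blast
      finally show ?thesis by (simp add: add_increasing)
    qed
  qed
  also have "\<dots> = 1 + (\<Sum>n. ennreal (exp (d * (real n + 1)) * tail F (real n)))"
    by (simp add: nn_integral_add nn_integral_suminf nn_integral_cmult emeasure_space_1[simplified] emeasure_greaterThan_eq_tail[OF F'] ennreal_mult' )
  also have "\<dots> < \<infinity>"
  proof -
    have "summable (\<lambda>n. exp (d * (real n + 1)) * tail F (real n))"
    proof (rule summable_comparison_test'[where N = 0])
      show "summable (\<lambda>n. C * exp d * exp (- d) ^ n)"
        using d by (intro summable_mult summable_geometric) simp
      fix n :: nat
      have "exp (d * (real n + 1)) * tail F (real n)
          = exp d * exp (- d) ^ n * (exp (\<epsilon> * real n) * tail F (real n))"
        by (simp add: d exp_add[symmetric] exp_of_nat_mult[symmetric] algebra_simps)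
      also have "\<dots> \<le> exp d * exp (- d) ^ n * C"
        by (intro mult_left_mono C) auto
      finally show "norm (exp (d * (real n + 1)) * tail F (real n)) \<le> C * exp d * exp (- d) ^ n"
        by (simp add: tail_nn abs_mult mult_ac)
    qed
    then have "(\<Sum>n. ennreal (exp (d * (real n + 1)) * tail F (real n))) \<noteq> \<top>"
      by (rule ennreal_suminf_neq_top) (simp add: tail_nn)
    then show ?thesis by (simp add: less_top)
  qed
  finally show False using inf[OF d(1)] by simp
qed

text \<open>By Markov's inequality a finite exponential moment bounds \<open>exp (\<epsilon> * x) * tail F x\<close>.\<close>

lemma heavy_tailedI:
  assumes F: "F \<in> tailed_distributions"
    and unb: "\<And>\<epsilon> K. 0 < \<epsilon> \<Longrightarrow> \<exists>x. K < exp (\<epsilon> * x) * tail F x"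
  shows "F \<in> heavy_tailed"
proof -
  interpret real_distribution F using F by (simp add: tailed_distributions_def)
  have "(\<integral>\<^sup>+ y. ennreal (exp (\<epsilon> * y)) \<partial>F) = \<infinity>" if "0 < \<epsilon>" for \<epsilon>
  proof (rule ccontr)
    assume "\<not> ?thesis"
    then obtain r where r: "0 \<le> r" "(\<integral>\<^sup>+ y. ennreal (exp (\<epsilon> * y)) \<partial>F) = ennreal r"
      by (metis ennreal_cases infinity_ennreal_def)
    obtain x where x: "r < exp (\<epsilon> * x) * tail F x" using unb[OF \<open>0 < \<epsilon>\<close>] by blast
    have "ennreal (exp (\<epsilon> * x) * tail F x) = (\<integral>\<^sup>+ y. ennreal (exp (\<epsilon> * x)) * indicator {x<..} y \<partial>F)"
      by (simp add: nn_integral_cmult_indicator ennreal_mult'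
          emeasure_greaterThan_eq_tail[OF real_distribution_axioms])
    also have "\<dots> \<le> (\<integral>\<^sup>+ y. ennreal (exp (\<epsilon> * y)) \<partial>F)"
      using \<open>0 < \<epsilon>\<close> by (intro nn_integral_mono) (auto split: split_indicator intro!: ennreal_leI)
    finally show False using x r by simp
  qed
  with F show ?thesis by (simp add: heavy_tailed_def)
qed

section \<open>Bounds from limits superior and an error budget\<close>

lemma Limsup_ereal_less_PInf_D:
  fixes f :: "'b \<Rightarrow> real"
  assumes "Limsup A (\<lambda>x. ereal (f x)) < \<infinity>"
  obtains C where "\<forall>\<^sub>F x in A. f x \<le> C"
proof -
  obtain n :: nat where "Limsup A (\<lambda>x. ereal (f x)) < ereal (real n)"
    using less_PInf_Ex_of_nat[THEN iffD1, of "Limsup A (\<lambda>x. ereal (f x))"] assms by auto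
  from Limsup_lessD[OF this] have "\<forall>\<^sub>F x in A. f x \<le> real n"
    by (auto elim!: eventually_mono)
  then show thesis by (rule that)
qed

text \<open>An error budget: two factors \<open>1 + d\<close>, one for comparing conditional tails and one for the
  tail of \<open>X\<close>, and two additive errors \<open>d\<close>.\<close>

lemma small_slack:
  fixes e :: real
  assumes "0 < e"
  obtains d where "0 < d" "(1 + d) * (1 + d) + 2 * d \<le> 1 + e"
proof (rule that[of "min 1 (e / 5)"])
  show "0 < min 1 (e / 5)" using assms by simp
  let ?d = "min 1 (e / 5)"
  have "?d * ?d \<le> ?d * 1" using assms by (intro mult_left_mono) auto
  moreover have "5 * ?d \<le> e" by auto
  ultimately show "(1 + ?d) * (1 + ?d) + 2 * ?d \<le> 1 + e"
    by (simp only: distrib_left distrib_right)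
qed

section \<open>Products whose conditional tails are comparable\<close>

text \<open>The uniform equivalence of the conditional tails with \<open>h y\<close> times the tail of \<open>X\<close> enters
  only through its consequence \<open>cond_tails_comparable\<close>: conditional tails at two levels \<open>u\<close> and \<open>v\<close>
  have almost the same ratio as the tails of \<open>X\<close> at these levels, with one threshold for almost
  all \<open>y\<close>. The function \<open>h\<close>, a priori not measurable, cancels in this ratio. Written without
  quotients, the comparison can be integrated over \<open>y\<close> directly.\<close>

locale dependent_product = prob_space M for M :: "'a measure" +
  fixes X Y :: "'a \<Rightarrow> real" and \<kappa> :: "real \<Rightarrow> real measure"
  assumes X[measurable]: "X \<in> borel_measurable M"
    and Y[measurable]: "Y \<in> borel_measurable M"
    and cond: "regular_cond_distr M X Y \<kappa>"
    and X_tail_pos: "\<And>u. 0 < tail (distr M borel X) u"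
    and Y_nonneg: "AE \<omega> in M. 0 \<le> Y \<omega>"
    and Y_pos: "0 < prob {\<omega> \<in> space M. 0 < Y \<omega>}"
    and cond_tail_pos: "AE y in distr M borel Y. \<forall>u. 0 < measure (\<kappa> y) {u<..}"
    and cond_tails_comparable: "\<And>R. 1 < R \<Longrightarrow> \<exists>x0. AE y in distr M borel Y. \<forall>u\<ge>x0. \<forall>v\<ge>x0.
        measure (\<kappa> y) {u<..} * tail (distr M borel X) v \<le> R * measure (\<kappa> y) {v<..} * tail (distr M borel X) u"
    and factor_tail_negligible: "\<And>c. 0 < c \<Longrightarrow>
        (\<lambda>x. tail (distr M borel Y) (c * x)) \<in> o[at_top](\<lambda>x. tail (distr M borel (\<lambda>\<omega>. X \<omega> * Y \<omega>)) x)"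
begin

abbreviation "F \<equiv> distr M borel X"
abbreviation "G \<equiv> distr M borel Y"
abbreviation "H \<equiv> distr M borel (\<lambda>\<omega>. X \<omega> * Y \<omega>)"

abbreviation tails_comparable :: "real \<Rightarrow> real \<Rightarrow> bool" where
  "tails_comparable R x0 \<equiv> (AE y in G. \<forall>u\<ge>x0. \<forall>v\<ge>x0.
      measure (\<kappa> y) {u<..} * tail F v \<le> R * measure (\<kappa> y) {v<..} * tail F u)"

lemma comparable_threshold:
  assumes "1 < R"
  obtains x0 where "0 < x0" "tails_comparable R x0"
proof -
  obtain x0 where "tails_comparable R x0"
    using cond_tails_comparable[OF assms] by blast
  then have "tails_comparable R (max x0 1)"
    by eventually_elim auto
  then show thesis by (intro that[of "max x0 1"]) auto
qed

lemmas prob_space_cond = regular_cond_distr_kernel(1)[OF cond]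

lemma cond_measurable [measurable]: "\<kappa> \<in> borel \<rightarrow>\<^sub>M prob_algebra borel"
  using cond by (simp add: regular_cond_distr_def)

lemma cond_tail_measurable [measurable]:
  assumes [measurable]: "f \<in> borel_measurable borel"
  shows "(\<lambda>y. measure (\<kappa> y) {f y<..}) \<in> borel_measurable borel"
proof (rule measure_measurable_prob_algebra2)
  have "(SIGMA y:space borel. {f y<..}) = {p \<in> space (borel \<Otimes>\<^sub>M borel). f (fst p) < snd p}"
    by (auto simp: space_pair_measure)
  also have "\<dots> \<in> sets (borel \<Otimes>\<^sub>M borel)" by measurable
  finally show "(SIGMA y:space borel. {f y<..}) \<in> sets (borel \<Otimes>\<^sub>M borel)" .
qed measurable

lemma prob_product_gt_eq_integral:
  assumes "B \<in> sets borel" "B \<subseteq> {0<..}"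
  shows "ennreal (prob {\<omega> \<in> space M. x < X \<omega> * Y \<omega> \<and> Y \<omega> \<in> B}) =
         (\<integral>\<^sup>+ y \<in> B. ennreal (measure (\<kappa> y) {x / y<..}) \<partial>G)"
proof -
  have [measurable]: "B \<in> sets borel" by fact
  let ?S = "{p \<in> space (borel \<Otimes>\<^sub>M borel :: (real \<times> real) measure). x < fst p * snd p \<and> snd p \<in> B}"
  have "?S \<in> sets (borel \<Otimes>\<^sub>M borel)" by measurable
  from regular_cond_distr_disintegration[OF prob_space_axioms X Y cond this]
  have "emeasure M {\<omega> \<in> space M. (X \<omega>, Y \<omega>) \<in> ?S} = (\<integral>\<^sup>+ y. emeasure (\<kappa> y) {u. (u, y) \<in> ?S} \<partial>G)" .
  also have "{\<omega> \<in> space M. (X \<omega>, Y \<omega>) \<in> ?S} = {\<omega> \<in> space M. x < X \<omega> * Y \<omega> \<and> Y \<omega> \<in> B}"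
    by (auto simp: space_pair_measure)
  also have "(\<integral>\<^sup>+ y. emeasure (\<kappa> y) {u. (u, y) \<in> ?S} \<partial>G) =
      (\<integral>\<^sup>+ y \<in> B. ennreal (measure (\<kappa> y) {x / y<..}) \<partial>G)"
  proof (rule nn_integral_cong)
    fix y :: real
    interpret k: prob_space "\<kappa> y" by (rule prob_space_cond)
    have "{u. (u, y) \<in> ?S} = (if y \<in> B then {x / y<..} else {})"
      using assms(2) by (auto simp: space_pair_measure pos_divide_less_eq)
    then show "emeasure (\<kappa> y) {u. (u, y) \<in> ?S} = ennreal (measure (\<kappa> y) {x / y<..}) * indicator B y"
      by (simp add: k.emeasure_eq_measure)
  qed
  finally show ?thesis by (simp add: emeasure_eq_measure)
qed

lemma prob_joint_gt_eq_integral: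
  assumes "B \<in> sets borel"
  shows "ennreal (prob {\<omega> \<in> space M. x < X \<omega> \<and> Y \<omega> \<in> B}) =
         (\<integral>\<^sup>+ y \<in> B. ennreal (measure (\<kappa> y) {x<..}) \<partial>G)"
proof -
  have "emeasure M {\<omega> \<in> space M. X \<omega> \<in> {x<..} \<and> Y \<omega> \<in> B} = (\<integral>\<^sup>+ y \<in> B. emeasure (\<kappa> y) {x<..} \<partial>G)"
    using cond assms by (auto simp: regular_cond_distr_def simp del: greaterThan_iff)
  also have "\<dots> = (\<integral>\<^sup>+ y \<in> B. ennreal (measure (\<kappa> y) {x<..}) \<partial>G)"
    using prob_space_cond by (simp add: finite_measure.emeasure_eq_measure prob_space.finite_measure)
  finally show ?thesis by (simp add: emeasure_eq_measure)
qed

lemma tail_H_eq: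
  assumes "0 \<le> x"
  shows "tail H x = prob {\<omega> \<in> space M. x < X \<omega> * Y \<omega> \<and> 0 < Y \<omega>}"
proof -
  have "tail H x = prob {\<omega> \<in> space M. x < X \<omega> * Y \<omega>}"
    by (simp add: tail_distr)
  also have "\<dots> = prob {\<omega> \<in> space M. x < X \<omega> * Y \<omega> \<and> 0 < Y \<omega>}"
    using Y_nonneg assms
    by (intro finite_measure_eq_AE) (auto elim!: eventually_mono simp: order_le_less)
  finally show ?thesis .
qed

text \<open>The mechanism behind the first three classes. A bound \<open>L\<close> for the effect on the tail of \<open>X\<close> of
  replacing \<open>x / y\<close> by \<open>x' / y\<close> becomes, by comparability, a bound \<open>R * L\<close> for the conditional tails,
  and integrating over \<open>y\<close> compares the two product tails. The asymptotic comparison applies only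
  where \<open>x' / y \<ge> x1\<close>; the remaining event \<open>Y > x' / x1\<close> is paid for with the tail of \<open>Y\<close>.\<close>

lemma prob_product_shift_le:
  assumes R: "0 < R" and x0: "tails_comparable R x0"
    and x1: "0 < x1" "x0 \<le> x1" and x: "0 \<le> x" "x' \<le> x" and L: "0 \<le> L" and \<eta>: "0 \<le> \<eta>"
    and shift: "\<And>y. \<eta> < y \<Longrightarrow> y \<le> x' / x1 \<Longrightarrow> tail F (x' / y) \<le> L * tail F (x / y)"
  shows "prob {\<omega> \<in> space M. x' < X \<omega> * Y \<omega> \<and> \<eta> < Y \<omega>} \<le> R * L * tail H x + tail G (x' / x1)"
proof -
  let ?B = "{\<eta><..x' / x1}"
  have B: "?B \<in> sets borel" "?B \<subseteq> {0<..}" using \<eta> by auto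
  have "ennreal (prob {\<omega> \<in> space M. x' < X \<omega> * Y \<omega> \<and> Y \<omega> \<in> ?B})
      = (\<integral>\<^sup>+ y \<in> ?B. ennreal (measure (\<kappa> y) {x' / y<..}) \<partial>G)"
    by (rule prob_product_gt_eq_integral[OF B])
  also have "\<dots> \<le> (\<integral>\<^sup>+ y. ennreal (R * L) * (ennreal (measure (\<kappa> y) {x / y<..}) * indicator ?B y) \<partial>G)"
  proof (rule nn_integral_mono_AE, use x0 in eventually_elim)
    fix y assume y: "\<forall>u\<ge>x0. \<forall>v\<ge>x0.
      measure (\<kappa> y) {u<..} * tail F v \<le> R * measure (\<kappa> y) {v<..} * tail F u"
    show "ennreal (measure (\<kappa> y) {x' / y<..}) * indicator ?B y
        \<le> ennreal (R * L) * (ennreal (measure (\<kappa> y) {x / y<..}) * indicator ?B y)"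
    proof (cases "y \<in> ?B")
      case True
      then have "0 < y" using \<eta> by auto
      have u: "x1 \<le> x' / y" using True \<open>0 < y\<close> x1 by (simp add: field_simps)
      have v: "x' / y \<le> x / y" using x \<open>0 < y\<close> by (simp add: divide_right_mono)
      have "measure (\<kappa> y) {x' / y<..} * tail F (x / y)
          \<le> R * measure (\<kappa> y) {x / y<..} * tail F (x' / y)"
        using y u v x1 by auto
      also have "\<dots> \<le> R * measure (\<kappa> y) {x / y<..} * (L * tail F (x / y))"
        using True R by (intro mult_left_mono shift) auto
      also have "\<dots> = (R * L * measure (\<kappa> y) {x / y<..}) * tail F (x / y)"
        by (simp add: mult_ac)
      finally have "measure (\<kappa> y) {x' / y<..} \<le> R * L * measure (\<kappa> y) {x / y<..}"
        using X_tail_pos[of "x / y"] by (simp only: mult_le_cancel_right_pos)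
      then have "ennreal (measure (\<kappa> y) {x' / y<..}) \<le> ennreal (R * L * measure (\<kappa> y) {x / y<..})"
        by (rule ennreal_leI)
      then show ?thesis using True R L by (simp add: ennreal_mult)
    qed simp
  qed
  also have "\<dots> = ennreal (R * L) * (\<integral>\<^sup>+ y \<in> ?B. ennreal (measure (\<kappa> y) {x / y<..}) \<partial>G)"
    by (rule nn_integral_cmult) measurable
  also have "\<dots> = ennreal (R * L * prob {\<omega> \<in> space M. x < X \<omega> * Y \<omega> \<and> Y \<omega> \<in> ?B})"
    unfolding prob_product_gt_eq_integral[OF B, symmetric] using R L by (simp add: ennreal_mult)
  finally have "prob {\<omega> \<in> space M. x' < X \<omega> * Y \<omega> \<and> Y \<omega> \<in> ?B}
      \<le> R * L * prob {\<omega> \<in> space M. x < X \<omega> * Y \<omega> \<and> Y \<omega> \<in> ?B}"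
    using R L by (subst (asm) ennreal_le_iff) auto
  also have "\<dots> \<le> R * L * prob {\<omega> \<in> space M. x < X \<omega> * Y \<omega>}"
    using R L by (intro mult_left_mono finite_measure_mono) auto
  finally have 1: "prob {\<omega> \<in> space M. x' < X \<omega> * Y \<omega> \<and> Y \<omega> \<in> ?B} \<le> R * L * tail H x"
    by (simp add: tail_distr)
  have "prob {\<omega> \<in> space M. x' < X \<omega> * Y \<omega> \<and> \<eta> < Y \<omega>}
      \<le> prob ({\<omega> \<in> space M. x' < X \<omega> * Y \<omega> \<and> Y \<omega> \<in> ?B} \<union> {\<omega> \<in> space M. x' / x1 < Y \<omega>})"
    by (intro finite_measure_mono) auto
  also have "\<dots> \<le> prob {\<omega> \<in> space M. x' < X \<omega> * Y \<omega> \<and> Y \<omega> \<in> ?B} + prob {\<omega> \<in> space M. x' / x1 < Y \<omega>}"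
    by (rule measure_Un_le) measurable
  finally show ?thesis using 1 by (simp add: tail_distr)
qed

lemma prob_joint_comparable:
  assumes R: "0 < R" and x0: "tails_comparable R x0"
    and B: "B \<in> sets borel" and u: "x0 \<le> u" and v: "x0 \<le> v"
  shows "prob {\<omega> \<in> space M. u < X \<omega> \<and> Y \<omega> \<in> B} * tail F v
         \<le> R * prob {\<omega> \<in> space M. v < X \<omega> \<and> Y \<omega> \<in> B} * tail F u"
proof -
  have [measurable]: "B \<in> sets borel" by fact
  have nn: "0 \<le> tail F t" for t using X_tail_pos[of t] by simp
  have "ennreal (tail F v * prob {\<omega> \<in> space M. u < X \<omega> \<and> Y \<omega> \<in> B})
      = (\<integral>\<^sup>+ y. ennreal (tail F v) * (ennreal (measure (\<kappa> y) {u<..}) * indicator B y) \<partial>G)"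
    by (simp add: nn_integral_cmult prob_joint_gt_eq_integral[OF B] ennreal_mult nn)
  also have "\<dots> \<le> (\<integral>\<^sup>+ y. ennreal (R * tail F u) * (ennreal (measure (\<kappa> y) {v<..}) * indicator B y) \<partial>G)"
  proof (rule nn_integral_mono_AE, use x0 in eventually_elim)
    fix y assume y: "\<forall>u\<ge>x0. \<forall>v\<ge>x0.
      measure (\<kappa> y) {u<..} * tail F v \<le> R * measure (\<kappa> y) {v<..} * tail F u"
    then have "ennreal (tail F v * measure (\<kappa> y) {u<..}) \<le> ennreal (R * tail F u * measure (\<kappa> y) {v<..})"
      using u v by (intro ennreal_leI) (simp add: mult_ac)
    then show "ennreal (tail F v) * (ennreal (measure (\<kappa> y) {u<..}) * indicator B y)
        \<le> ennreal (R * tail F u) * (ennreal (measure (\<kappa> y) {v<..}) * indicator B y)"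
      using R by (auto simp: ennreal_mult nn split: split_indicator)
  qed
  also have "\<dots> = ennreal (R * tail F u * prob {\<omega> \<in> space M. v < X \<omega> \<and> Y \<omega> \<in> B})"
    using R by (simp add: nn_integral_cmult prob_joint_gt_eq_integral[OF B] ennreal_mult nn)
  finally show ?thesis
    using R nn by (subst (asm) ennreal_le_iff) (auto simp: mult_ac)
qed

text \<open>On \<open>Y \<ge> \<eta>0\<close> the event \<open>X > u\<close>, with \<open>u > 0\<close>, forces \<open>X * Y > \<eta> * u\<close>, and conditionally on such a \<open>Y\<close> the
  variable \<open>X\<close> still has a tail of the order of that of \<open>F\<close>. The constant \<open>c\<close> is uniform in
  \<open>\<eta> \<le> \<eta>0\<close>, which is what lets a small \<open>\<eta>\<close> be chosen afterwards.\<close>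

lemma tail_H_lower_bound:
  "\<exists>c \<eta>0 u0. 0 < c \<and> 0 < \<eta>0 \<and> (\<forall>u\<ge>u0. \<forall>\<eta>. 0 < \<eta> \<and> \<eta> \<le> \<eta>0 \<longrightarrow> c * tail F u \<le> tail H (\<eta> * u))"
proof -
  obtain x0 where x0: "0 < x0" and cmp: "tails_comparable 2 x0"
    using comparable_threshold[of 2] by auto
  obtain \<eta>0 where \<eta>0: "0 < \<eta>0" "0 < prob {\<omega> \<in> space M. \<eta>0 \<le> Y \<omega>}"
  proof -
    have "(\<lambda>n. prob {\<omega> \<in> space M. 1 / real (Suc n) \<le> Y \<omega>}) \<longlonglongrightarrow> prob (\<Union>n. {\<omega> \<in> space M. 1 / real (Suc n) \<le> Y \<omega>})"
      by (intro finite_Lim_measure_incseq)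
        (auto simp: incseq_def intro: order_trans[rotated] intro!: divide_left_mono)
    also have "(\<Union>n. {\<omega> \<in> space M. 1 / real (Suc n) \<le> Y \<omega>}) = {\<omega> \<in> space M. 0 < Y \<omega>}"
    proof -
      have "(\<exists>n. 1 / real (Suc n) \<le> t) \<longleftrightarrow> 0 < t" for t :: real
        by (meson less_imp_le less_le_trans nat_approx_posE of_nat_0_less_iff zero_less_Suc zero_less_divide_1_iff)
      then show ?thesis by auto
    qed
    finally have "\<forall>\<^sub>F n in sequentially. 0 < prob {\<omega> \<in> space M. 1 / real (Suc n) \<le> Y \<omega>}"
      by (rule order_tendstoD(1)) (rule Y_pos)
    then obtain n where "0 < prob {\<omega> \<in> space M. 1 / real (Suc n) \<le> Y \<omega>}"
      using eventually_happens' sequentially_bot by blast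
    then show thesis by (intro that[of "1 / real (Suc n)"]) auto
  qed
  define q where "q = prob {\<omega> \<in> space M. x0 < X \<omega> \<and> Y \<omega> \<in> {\<eta>0..}}"
  \<comment> \<open>Otherwise \<open>P[X > x0 | Y = y]\<close> would vanish for almost every \<open>y \<ge> \<eta>0\<close>.\<close>
  have "0 < q"
  proof (rule ccontr)
    assume "\<not> 0 < q"
    then have "q = 0" using measure_nonneg[of M] by (simp add: q_def not_less antisym)
    then have "(\<integral>\<^sup>+ y \<in> {\<eta>0..}. ennreal (measure (\<kappa> y) {x0<..}) \<partial>G) = 0"
      unfolding q_def using prob_joint_gt_eq_integral[of "{\<eta>0..}" x0] by simp
    then have "AE y in G. ennreal (measure (\<kappa> y) {x0<..}) * indicator {\<eta>0..} y = 0"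
      by (subst (asm) nn_integral_0_iff_AE) measurable
    with cond_tail_pos have "AE y in G. \<not> \<eta>0 \<le> y"
    proof eventually_elim
      case (elim y)
      then have "0 < measure (\<kappa> y) {x0<..}" by blast
      with elim show ?case by (auto split: split_indicator_asm)
    qed
    then have "AE \<omega> in M. \<not> \<eta>0 \<le> Y \<omega>" by (simp add: AE_distr_iff)
    then have "prob {\<omega> \<in> space M. \<eta>0 \<le> Y \<omega>} = 0" by (subst prob_eq_0) (auto elim!: eventually_mono)
    with \<eta>0 show False by simp
  qed
  define c where "c = q / (2 * tail F x0)"
  show ?thesis
  proof (rule exI[of _ c], rule exI[of _ \<eta>0], rule exI[of _ x0], intro conjI allI impI)
    show "0 < c" using \<open>0 < q\<close> X_tail_pos[of x0] by (simp add: c_def)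
    fix u \<eta> assume u: "x0 \<le> u" and "0 < \<eta> \<and> \<eta> \<le> \<eta>0"
    then have \<eta>: "0 < \<eta>" "\<eta> \<le> \<eta>0" by simp_all
    have "q * tail F u \<le> 2 * prob {\<omega> \<in> space M. u < X \<omega> \<and> Y \<omega> \<in> {\<eta>0..}} * tail F x0"
      unfolding q_def by (rule prob_joint_comparable[OF _ cmp]) (use u in auto)
    also have "prob {\<omega> \<in> space M. u < X \<omega> \<and> Y \<omega> \<in> {\<eta>0..}} \<le> tail H (\<eta> * u)"
    proof -
      have "\<eta> * u < X \<omega> * Y \<omega>" if "u < X \<omega>" "\<eta>0 \<le> Y \<omega>" for \<omega>
      proof -
        have "\<eta> * u < \<eta> * X \<omega>" using that \<eta> by simp
        also have "\<dots> \<le> Y \<omega> * X \<omega>" using that \<eta> u x0 by (intro mult_right_mono) auto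
        finally show ?thesis by (simp add: mult.commute)
      qed
      then show ?thesis by (auto simp: tail_distr intro!: finite_measure_mono)
    qed
    finally show "c * tail F u \<le> tail H (\<eta> * u)"
      using X_tail_pos[of x0] by (simp add: c_def field_simps)
  qed (rule \<eta>0)
qed

text \<open>Counterpart of the lower bound: for \<open>0 < Y \<le> \<eta>\<close> and \<open>u > 0\<close> the event
  \<open>X * Y > \<eta> * u\<close> forces \<open>X > u\<close>, so its probability has the order of \<open>tail F u\<close>, multiplied by a probability that
  vanishes with \<open>\<eta>\<close>.\<close>

lemma prob_product_small_factor_le:
  "\<exists>C>0. \<exists>u0. \<forall>u\<ge>u0. \<forall>\<eta>>0. prob {\<omega> \<in> space M. \<eta> * u < X \<omega> * Y \<omega> \<and> 0 < Y \<omega> \<and> Y \<omega> \<le> \<eta>}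
        \<le> C * prob {\<omega> \<in> space M. 0 < Y \<omega> \<and> Y \<omega> \<le> \<eta>} * tail F u"
proof -
  obtain x0 where x0: "0 < x0" and cmp: "tails_comparable 2 x0"
    using comparable_threshold[of 2] by auto
  show ?thesis
  proof (rule exI[of _ "2 / tail F x0"], intro conjI exI[of _ x0] allI impI)
    fix u \<eta> assume u: "x0 \<le> u" and \<eta>: "0 < (\<eta>::real)"
    have "u < X \<omega>" if "\<eta> * u < X \<omega> * Y \<omega>" "0 < Y \<omega>" "Y \<omega> \<le> \<eta>" for \<omega>
    proof -
      have "0 < X \<omega> * Y \<omega>" using that u x0 \<eta> by (meson less_trans mult_pos_pos less_le_trans)
      then have "0 < X \<omega>" using that by (simp add: zero_less_mult_iff)
      then have "X \<omega> * Y \<omega> \<le> X \<omega> * \<eta>" using that by simp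
      also have "\<dots> = \<eta> * X \<omega>" by simp
      finally have "\<eta> * u < \<eta> * X \<omega>" using that by linarith
      then show ?thesis using \<eta> by simp
    qed
    then have "prob {\<omega> \<in> space M. \<eta> * u < X \<omega> * Y \<omega> \<and> 0 < Y \<omega> \<and> Y \<omega> \<le> \<eta>}
        \<le> prob {\<omega> \<in> space M. u < X \<omega> \<and> Y \<omega> \<in> {0<..\<eta>}}"
      by (intro finite_measure_mono) auto
    then have "prob {\<omega> \<in> space M. \<eta> * u < X \<omega> * Y \<omega> \<and> 0 < Y \<omega> \<and> Y \<omega> \<le> \<eta>} * tail F x0
        \<le> prob {\<omega> \<in> space M. u < X \<omega> \<and> Y \<omega> \<in> {0<..\<eta>}} * tail F x0"
      using X_tail_pos[of x0] by simp
    also have "\<dots> \<le> 2 * prob {\<omega> \<in> space M. x0 < X \<omega> \<and> Y \<omega> \<in> {0<..\<eta>}} * tail F u"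
      by (rule prob_joint_comparable[OF _ cmp]) (use u in auto)
    also have "\<dots> \<le> 2 * prob {\<omega> \<in> space M. 0 < Y \<omega> \<and> Y \<omega> \<le> \<eta>} * tail F u"
      using X_tail_pos[of u] by (intro mult_mono finite_measure_mono) auto
    finally show "prob {\<omega> \<in> space M. \<eta> * u < X \<omega> * Y \<omega> \<and> 0 < Y \<omega> \<and> Y \<omega> \<le> \<eta>}
        \<le> 2 / tail F x0 * prob {\<omega> \<in> space M. 0 < Y \<omega> \<and> Y \<omega> \<le> \<eta>} * tail F u"
      using X_tail_pos[of x0] by (simp add: field_simps)
  qed (use X_tail_pos[of x0] in auto)
qed

lemma tail_H_pos: "0 < tail H x"
proof -
  obtain c \<eta>0 u0 where *: "0 < c" "0 < \<eta>0"
    "\<And>u \<eta>. u0 \<le> u \<Longrightarrow> 0 < \<eta> \<Longrightarrow> \<eta> \<le> \<eta>0 \<Longrightarrow> c * tail F u \<le> tail H (\<eta> * u)"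
    using tail_H_lower_bound by blast
  define u where "u = max u0 (x / \<eta>0)"
  have "0 < c * tail F u" using * X_tail_pos by simp
  also have "\<dots> \<le> tail H (\<eta>0 * u)" using * by (simp add: u_def)
  also have "\<dots> \<le> tail H x"
  proof (rule tail_antimono)
    have "\<eta>0 * (x / \<eta>0) \<le> \<eta>0 * u" using * by (intro mult_left_mono) (auto simp: u_def)
    then show "x \<le> \<eta>0 * u" using * by simp
  qed simp
  finally show ?thesis .
qed

lemma H_tailed: "H \<in> tailed_distributions"
  using tail_H_pos by (simp add: tailed_distributions_def)

lemma factor_tail_le:
  assumes "0 < c" "0 < \<epsilon>"
  shows "\<forall>\<^sub>F x in at_top. tail G (c * x) \<le> \<epsilon> * tail H x"
  using landau_o.smallD[OF factor_tail_negligible[OF assms(1)] assms(2)]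
  by eventually_elim (use tail_H_pos in \<open>auto simp: abs_le_iff less_imp_le\<close>)

text \<open>The multiplicative shift \<open>x' = b * x\<close>: dividing by \<open>y\<close> turns it into the same multiplicative shift
  of the argument \<open>x / y\<close>, so a bound for \<open>F\<close> serves for every \<open>y\<close>.\<close>

lemma tail_H_scale_le:
  assumes b: "0 < b" "b < 1" and F: "\<forall>\<^sub>F x in at_top. tail F (b * x) \<le> L * tail F x"
    and R: "1 < R" and \<epsilon>: "0 < \<epsilon>"
  shows "\<forall>\<^sub>F x in at_top. tail H (b * x) \<le> (R * L + \<epsilon>) * tail H x"
proof -
  obtain x0 where x0: "0 < x0" and cmp: "tails_comparable R x0"
    using comparable_threshold[OF R] by auto
  obtain x2 where x2: "\<And>x. x2 \<le> x \<Longrightarrow> tail F (b * x) \<le> L * tail F x"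
    using F by (auto simp: eventually_at_top_linorder)
  define x1 where "x1 = max x0 x2"
  have x1: "0 < x1" "x0 \<le> x1" "x2 \<le> x1" using x0 by (auto simp: x1_def)
  have "0 < L * tail F x2" using x2[of x2] X_tail_pos[of "b * x2"] by simp
  then have L: "0 \<le> L" using X_tail_pos[of x2] by (simp add: zero_less_mult_iff)
  have "0 < b / x1" using b x1 by simp
  from factor_tail_le[OF this \<epsilon>] eventually_ge_at_top[of 0] show ?thesis
  proof eventually_elim
    case (elim x)
    have "tail H (b * x) = prob {\<omega> \<in> space M. b * x < X \<omega> * Y \<omega> \<and> 0 < Y \<omega>}"
      using elim b by (intro tail_H_eq) simp
    also have "\<dots> \<le> R * L * tail H x + tail G (b * x / x1)"
    proof (rule prob_product_shift_le[OF _ cmp])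
      fix y assume y: "0 < y" "y \<le> b * x / x1"
      then have "x1 * y \<le> b * x" using x1 by (simp add: field_simps)
      also have "\<dots> \<le> x" using b elim by (simp add: mult_left_le_one_le)
      finally have "x1 \<le> x / y" using y by (simp add: field_simps)
      then show "tail F (b * x / y) \<le> L * tail F (x / y)" using x2[of "x / y"] x1 by simp
    qed (use R x1 L b elim in \<open>auto simp: mult_left_le_one_le\<close>)
    also have "\<dots> \<le> R * L * tail H x + \<epsilon> * tail H x" using elim by simp
    finally show ?case by (simp add: algebra_simps)
  qed
qed

section \<open>Transfer of the four classes to the product\<close>

lemma dominatedly_varying_product:
  assumes "F \<in> dominatedly_varying"
  shows "H \<in> dominatedly_varying"
proof -
  have "Limsup at_top (\<lambda>x. ereal (tail H (b * x) / tail H x)) < \<infinity>" if b: "0 < b" "b < 1" for b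
  proof -
    have "Limsup at_top (\<lambda>x. ereal (tail F (b * x) / tail F x)) < \<infinity>"
      using assms b by (simp add: dominatedly_varying_def)
    then obtain C where "\<forall>\<^sub>F x in at_top. tail F (b * x) / tail F x \<le> C"
      by (rule Limsup_ereal_less_PInf_D)
    then have "\<forall>\<^sub>F x in at_top. tail F (b * x) \<le> C * tail F x"
      by eventually_elim (use X_tail_pos in \<open>simp add: divide_le_eq\<close>)
    from tail_H_scale_le[OF b this, of 2 1]
    have "\<forall>\<^sub>F x in at_top. ereal (tail H (b * x) / tail H x) \<le> ereal (2 * C + 1)"
      by (auto elim!: eventually_mono simp: divide_le_eq tail_H_pos)
    then have "Limsup at_top (\<lambda>x. ereal (tail H (b * x) / tail H x)) \<le> ereal (2 * C + 1)"
      by (rule Limsup_bounded)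
    then show ?thesis by (rule le_less_trans) simp
  qed
  with H_tailed show ?thesis by (simp add: dominatedly_varying_def)
qed

lemma consistently_varying_product:
  assumes "F \<in> consistently_varying"
  shows "H \<in> consistently_varying"
proof -
  let ?LH = "\<lambda>b. Limsup at_top (\<lambda>x. ereal (tail H (b * x) / tail H x))"
  let ?LF = "\<lambda>b. Limsup at_top (\<lambda>x. ereal (tail F (b * x) / tail F x))"
  have unit: "\<forall>\<^sub>F b in at_left (1::real). 0 < b \<and> b < 1"
    by (auto simp: eventually_at_left_field intro!: exI[of _ 0])
  have "(?LH \<longlongrightarrow> 1) (at_left 1)"
  proof (rule order_tendstoI)
    fix a :: ereal assume "a < 1"
    from unit show "\<forall>\<^sub>F b in at_left 1. a < ?LH b"
    proof eventually_elim
      case (elim b)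
      have "\<forall>\<^sub>F x in at_top. 1 \<le> ereal (tail H (b * x) / tail H x)"
        using eventually_ge_at_top[of 0]
      proof eventually_elim
        fix x :: real assume "0 \<le> x"
        with elim have "tail H x \<le> tail H (b * x)"
          by (intro tail_antimono) (auto simp: mult_left_le_one_le)
        then show "1 \<le> ereal (tail H (b * x) / tail H x)"
          using tail_H_pos[of x] by (simp add: le_divide_eq)
      qed
      then have "1 \<le> ?LH b" by (intro le_Limsup) simp_all
      with \<open>a < 1\<close> show ?case by (rule less_le_trans)
    qed
  next
    fix a :: ereal assume "1 < a"
    then obtain e where e: "0 < e" "ereal (1 + e) < a"
    proof -
      obtain r where "1 < ereal r" "ereal r < a" using \<open>1 < a\<close> ereal_dense2 by blast
      then show thesis by (intro that[of "r - 1"]) (auto simp: one_ereal_def)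
    qed
    obtain d where d: "0 < d" "(1 + d) * (1 + d) + 2 * d \<le> 1 + e"
      using small_slack[OF e(1)] by blast
    have "(?LF \<longlongrightarrow> 1) (at_left 1)"
      using assms by (simp add: consistently_varying_def)
    then have "\<forall>\<^sub>F b in at_left 1. ?LF b < ereal (1 + d)"
      by (rule order_tendstoD) (use d in \<open>simp add: one_ereal_def\<close>)
    with unit show "\<forall>\<^sub>F b in at_left 1. ?LH b < a"
    proof eventually_elim
      case (elim b)
      from Limsup_lessD[OF elim(2)]
      have "\<forall>\<^sub>F x in at_top. tail F (b * x) \<le> (1 + d) * tail F x"
        by eventually_elim (use X_tail_pos in \<open>simp add: divide_less_eq\<close>)
      from tail_H_scale_le[OF _ _ this, of "1 + d" d] elim d
      have "\<forall>\<^sub>F x in at_top. tail H (b * x) \<le> ((1 + d) * (1 + d) + d) * tail H x" by simp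
      then have "\<forall>\<^sub>F x in at_top. ereal (tail H (b * x) / tail H x) \<le> ereal (1 + e)"
      proof eventually_elim
        case (elim x)
        have "tail H (b * x) \<le> (1 + e) * tail H x"
          using d tail_H_pos[of x] by (intro order_trans[OF elim] mult_right_mono) auto
        then show ?case using tail_H_pos[of x] by (simp add: divide_le_eq)
      qed
      then have "?LH b \<le> ereal (1 + e)" by (rule Limsup_bounded)
      with e show ?case by simp
    qed
  qed
  with H_tailed show ?thesis by (simp add: consistently_varying_def)
qed

lemma prob_small_factor_tendsto_0:
  "((\<lambda>\<eta>. prob {\<omega> \<in> space M. 0 < Y \<omega> \<and> Y \<omega> \<le> \<eta>}) \<longlongrightarrow> 0) (at_right 0)"
proof -
  interpret G: real_distribution G by simp
  have "(cdf G \<longlongrightarrow> cdf G 0) (at_right 0)"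
    using G.cdf_is_right_cont[of 0] by (simp add: continuous_within)
  then have "((\<lambda>\<eta>. cdf G \<eta> - cdf G 0) \<longlongrightarrow> cdf G 0 - cdf G 0) (at_right 0)"
    by (intro tendsto_diff tendsto_const)
  moreover have "\<forall>\<^sub>F \<eta> in at_right 0. cdf G \<eta> - cdf G 0 = prob {\<omega> \<in> space M. 0 < Y \<omega> \<and> Y \<omega> \<le> \<eta>}"
    using eventually_at_right_less[of 0]
  proof eventually_elim
    fix \<eta> :: real assume "0 < \<eta>"
    then have "cdf G \<eta> - cdf G 0 = measure G {0<..\<eta>}" by (rule G.cdf_diff_eq)
    also have "\<dots> = prob {\<omega> \<in> space M. 0 < Y \<omega> \<and> Y \<omega> \<le> \<eta>}"
      by (subst measure_distr) (auto intro!: arg_cong[where f = prob])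
    finally show "cdf G \<eta> - cdf G 0 = prob {\<omega> \<in> space M. 0 < Y \<omega> \<and> Y \<omega> \<le> \<eta>}" .
  qed
  ultimately show ?thesis by (simp add: tendsto_cong)
qed

text \<open>For \<open>Y \<le> \<eta>\<close> the shift \<open>a / Y\<close> seen by \<open>X\<close> is unbounded and long-tailedness of \<open>F\<close> says nothing.
  But \<open>x - a \<ge> x / 2\<close> eventually, so by dominated variation the shift costs at most a
  constant \<open>D\<close>, and this part is of order \<open>P(0 < Y \<le> \<eta>)\<close> relative to the tail of the product.\<close>

lemma prob_shifted_product_small_factor_le:
  assumes F: "F \<in> dominatedly_varying" and "0 < d" "0 < a"
  obtains \<eta> where "0 < \<eta>" "\<forall>\<^sub>F x in at_top.
      prob {\<omega> \<in> space M. x - a < X \<omega> * Y \<omega> \<and> 0 < Y \<omega> \<and> Y \<omega> \<le> \<eta>} \<le> d * tail H x"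
proof -
  obtain c \<eta>0 u0 where c: "0 < c" "0 < \<eta>0" and
    low: "\<And>u \<eta>. u0 \<le> u \<Longrightarrow> 0 < \<eta> \<Longrightarrow> \<eta> \<le> \<eta>0 \<Longrightarrow> c * tail F u \<le> tail H (\<eta> * u)"
    using tail_H_lower_bound by blast
  obtain C u1 where C: "0 < C" and
    small: "\<And>u \<eta>. u1 \<le> u \<Longrightarrow> 0 < \<eta> \<Longrightarrow> prob {\<omega> \<in> space M. \<eta> * u < X \<omega> * Y \<omega> \<and> 0 < Y \<omega> \<and> Y \<omega> \<le> \<eta>}
        \<le> C * prob {\<omega> \<in> space M. 0 < Y \<omega> \<and> Y \<omega> \<le> \<eta>} * tail F u"
    using prob_product_small_factor_le by blast
  have "Limsup at_top (\<lambda>x. ereal (tail F (1 / 2 * x) / tail F x)) < \<infinity>"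
    using F by (simp add: dominatedly_varying_def del: times_divide_eq_left)
  then obtain D where "\<forall>\<^sub>F x in at_top. tail F (1 / 2 * x) / tail F x \<le> D"
    by (rule Limsup_ereal_less_PInf_D)
  then obtain x2 where x2: "\<And>x. x2 \<le> x \<Longrightarrow> tail F (1 / 2 * x) / tail F x \<le> D"
    unfolding eventually_at_top_linorder by blast
  have "0 < tail F (1 / 2 * x2) / tail F x2" using X_tail_pos by simp
  then have D: "0 < D" using x2[of x2] by linarith
  \<comment> \<open>\<open>p\<close> is chosen such that \<open>C * p * D = d * c\<close>.\<close>
  define p where "p = d * c / (C * D)"
  have "0 < p" using assms c C D by (simp add: p_def)
  have "\<forall>\<^sub>F \<eta> in at_right 0. prob {\<omega> \<in> space M. 0 < Y \<omega> \<and> Y \<omega> \<le> \<eta>} < p"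
    using order_tendstoD(2)[OF prob_small_factor_tendsto_0 \<open>0 < p\<close>] .
  moreover have "\<forall>\<^sub>F \<eta> in at_right (0::real). 0 < \<eta> \<and> \<eta> < \<eta>0"
    using c(2) by (auto simp: eventually_at_right_field)
  ultimately have "\<forall>\<^sub>F \<eta> in at_right 0. prob {\<omega> \<in> space M. 0 < Y \<omega> \<and> Y \<omega> \<le> \<eta>} < p \<and> 0 < \<eta> \<and> \<eta> < \<eta>0"
    by eventually_elim simp
  then obtain \<eta> where \<eta>: "prob {\<omega> \<in> space M. 0 < Y \<omega> \<and> Y \<omega> \<le> \<eta>} < p" "0 < \<eta>" "\<eta> < \<eta>0"
    using eventually_happens' trivial_limit_at_right_real by blast
  have "\<forall>\<^sub>F x in at_top. \<eta> * u0 \<le> x \<and> \<eta> * x2 \<le> x \<and> 2 * \<eta> * u1 \<le> x \<and> 2 * a \<le> x"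
    by (intro eventually_conj eventually_ge_at_top)
  then have "\<forall>\<^sub>F x in at_top. prob {\<omega> \<in> space M. x - a < X \<omega> * Y \<omega> \<and> 0 < Y \<omega> \<and> Y \<omega> \<le> \<eta>} \<le> d * tail H x"
  proof eventually_elim
    case (elim x)
    define u where "u = x / \<eta>"
    have x: "x = \<eta> * u" using \<eta> by (simp add: u_def)
    have u: "u0 \<le> u" "x2 \<le> u" "u1 \<le> 1 / 2 * u" using elim \<eta> by (auto simp: u_def field_simps)
    have "prob {\<omega> \<in> space M. x - a < X \<omega> * Y \<omega> \<and> 0 < Y \<omega> \<and> Y \<omega> \<le> \<eta>}
        \<le> prob {\<omega> \<in> space M. \<eta> * (1 / 2 * u) < X \<omega> * Y \<omega> \<and> 0 < Y \<omega> \<and> Y \<omega> \<le> \<eta>}"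
      using elim by (intro finite_measure_mono) (auto simp: x)
    also have "\<dots> \<le> C * prob {\<omega> \<in> space M. 0 < Y \<omega> \<and> Y \<omega> \<le> \<eta>} * tail F (1 / 2 * u)"
      by (rule small) (use u \<eta> in auto)
    also have "\<dots> \<le> C * p * (D * tail F u)"
      using x2[OF u(2)] X_tail_pos[of u] X_tail_pos[of "1 / 2 * u"] C \<eta> D \<open>0 < p\<close>
      by (intro mult_mono mult_left_mono) (auto simp: divide_le_eq)
    also have "\<dots> = d * (c * tail F u)" using C D by (simp add: p_def)
    also have "\<dots> \<le> d * tail H (\<eta> * u)"
      using low[OF u(1), of \<eta>] \<eta> assms by simp
    finally show ?case by (simp add: x)
  qed
  with \<eta> show thesis by (intro that)
qed

text \<open>For \<open>Y > \<eta>\<close> the shift \<open>a / Y\<close> seen by \<open>X\<close> is at most the fixed number \<open>a / \<eta>\<close>.\<close>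

lemma prob_shifted_product_large_factor_le:
  assumes F: "F \<in> long_tailed" and "0 < a" "0 < \<eta>" "0 < d"
  shows "\<forall>\<^sub>F x in at_top. prob {\<omega> \<in> space M. x - a < X \<omega> * Y \<omega> \<and> \<eta> < Y \<omega>}
      \<le> ((1 + d) * (1 + d) + d) * tail H x"
proof -
  obtain x0 where x0: "0 < x0" and cmp: "tails_comparable (1 + d) x0"
    using comparable_threshold[of "1 + d"] assms by auto
  have "((\<lambda>x. tail F (x - a / \<eta>) / tail F x) \<longlongrightarrow> 1) at_top"
    using assms by (simp add: long_tailed_def)
  then have "\<forall>\<^sub>F x in at_top. tail F (x - a / \<eta>) / tail F x < 1 + d"
    by (rule order_tendstoD) (use assms in simp)
  then obtain x2 where x2: "\<And>x. x2 \<le> x \<Longrightarrow> tail F (x - a / \<eta>) / tail F x < 1 + d"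
    by (auto simp: eventually_at_top_linorder)
  define x1 where "x1 = max x0 x2"
  have x1: "0 < x1" "x0 \<le> x1" "x2 \<le> x1" using x0 by (auto simp: x1_def)
  have "0 < 1 / (2 * x1)" using x1 by simp
  from factor_tail_le[OF this \<open>0 < d\<close>] eventually_ge_at_top[of "2 * a"] show ?thesis
  proof eventually_elim
    case (elim x)
    have "prob {\<omega> \<in> space M. x - a < X \<omega> * Y \<omega> \<and> \<eta> < Y \<omega>}
        \<le> (1 + d) * (1 + d) * tail H x + tail G ((x - a) / x1)"
    proof (rule prob_product_shift_le[OF _ cmp])
      fix y assume y: "\<eta> < y" "y \<le> (x - a) / x1"
      have "0 < y" using y assms by simp
      have "x1 \<le> x / y" using y \<open>0 < y\<close> x1 \<open>0 < a\<close> by (simp add: field_simps)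
      have "a / y \<le> a / \<eta>" using y assms by (intro divide_left_mono) auto
      then have "tail F ((x - a) / y) \<le> tail F (x / y - a / \<eta>)"
        by (intro tail_antimono) (auto simp: diff_divide_distrib)
      also have "\<dots> \<le> (1 + d) * tail F (x / y)"
        using x2[of "x / y"] \<open>x1 \<le> x / y\<close> x1 X_tail_pos[of "x / y"] by (simp add: divide_less_eq)
      finally show "tail F ((x - a) / y) \<le> (1 + d) * tail F (x / y)" .
    qed (use x1 assms elim in auto)
    also have "tail G ((x - a) / x1) \<le> tail G (1 / (2 * x1) * x)"
      using elim x1 by (intro tail_antimono) (auto simp: field_simps)
    also have "\<dots> \<le> d * tail H x" using elim by simp
    finally show ?case by (simp add: algebra_simps)
  qed
qed

lemma long_tailed_product:
  assumes D: "F \<in> dominatedly_varying" and L: "F \<in> long_tailed"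
  shows "H \<in> long_tailed"
proof -
  have "((\<lambda>x. tail H (x - a) / tail H x) \<longlongrightarrow> 1) at_top" if a: "0 < a" for a
  proof (rule order_tendstoI)
    fix l :: real assume "l < 1"
    have "l < tail H (x - a) / tail H x" for x
    proof -
      have "tail H x \<le> tail H (x - a)" using a by (intro tail_antimono) auto
      then have "1 \<le> tail H (x - a) / tail H x" using tail_H_pos[of x] by (simp add: le_divide_eq)
      with \<open>l < 1\<close> show ?thesis by linarith
    qed
    then show "\<forall>\<^sub>F x in at_top. l < tail H (x - a) / tail H x" by simp
  next
    fix r :: real assume "1 < r"
    then obtain d where d: "0 < d" "(1 + d) * (1 + d) + 2 * d \<le> 1 + (r - 1) / 2"
      using small_slack[of "(r - 1) / 2"] by auto
    obtain \<eta> where \<eta>: "0 < \<eta>" and small: "\<forall>\<^sub>F x in at_top.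
        prob {\<omega> \<in> space M. x - a < X \<omega> * Y \<omega> \<and> 0 < Y \<omega> \<and> Y \<omega> \<le> \<eta>} \<le> d * tail H x"
      using prob_shifted_product_small_factor_le[OF D d(1) a] by blast
    show "\<forall>\<^sub>F x in at_top. tail H (x - a) / tail H x < r"
      using small prob_shifted_product_large_factor_le[OF L a \<eta> d(1)] eventually_ge_at_top[of a]
    proof eventually_elim
      case (elim x)
      have "tail H (x - a) = prob {\<omega> \<in> space M. x - a < X \<omega> * Y \<omega> \<and> 0 < Y \<omega>}"
        using elim by (intro tail_H_eq) simp
      also have "\<dots> \<le> prob ({\<omega> \<in> space M. x - a < X \<omega> * Y \<omega> \<and> 0 < Y \<omega> \<and> Y \<omega> \<le> \<eta>}
          \<union> {\<omega> \<in> space M. x - a < X \<omega> * Y \<omega> \<and> \<eta> < Y \<omega>})"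
        by (intro finite_measure_mono) auto
      also have "\<dots> \<le> prob {\<omega> \<in> space M. x - a < X \<omega> * Y \<omega> \<and> 0 < Y \<omega> \<and> Y \<omega> \<le> \<eta>}
          + prob {\<omega> \<in> space M. x - a < X \<omega> * Y \<omega> \<and> \<eta> < Y \<omega>}"
        by (rule measure_Un_le) measurable
      also have "\<dots> \<le> d * tail H x + ((1 + d) * (1 + d) + d) * tail H x"
        using elim by (intro add_mono) auto
      also have "\<dots> = ((1 + d) * (1 + d) + 2 * d) * tail H x" by (simp add: algebra_simps)
      also have "\<dots> < r * tail H x"
      proof (rule mult_strict_right_mono)
        have "1 + (r - 1) / 2 < r" using \<open>1 < r\<close> by (simp add: field_simps)
        with d(2) show "(1 + d) * (1 + d) + 2 * d < r" by (rule le_less_trans)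
      qed (rule tail_H_pos)
      finally show ?case using tail_H_pos[of x] by (simp add: divide_less_eq)
    qed
  qed
  with H_tailed show ?thesis by (simp add: long_tailed_def)
qed

text \<open>The lower bound on the tail of the product carries the unbounded growth of
  \<open>exp (\<epsilon> * \<eta> * u) * tail F u\<close> over to \<open>H\<close>, at the points \<open>\<eta> * u\<close>.\<close>

lemma heavy_tailed_product:
  assumes F: "F \<in> heavy_tailed"
  shows "H \<in> heavy_tailed"
proof (rule heavy_tailedI[OF H_tailed])
  fix \<epsilon> K :: real assume "0 < \<epsilon>"
  obtain c \<eta> u0 where c: "0 < c" "0 < \<eta>" and
    low: "\<And>u. u0 \<le> u \<Longrightarrow> c * tail F u \<le> tail H (\<eta> * u)"
    using tail_H_lower_bound by blast
  obtain u where u: "u0 \<le> u" "K / c < exp (\<epsilon> * \<eta> * u) * tail F u"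
    using heavy_tailed_exp_times_tail_unbounded[OF F, of "\<epsilon> * \<eta>" u0 "K / c"] \<open>0 < \<epsilon>\<close> c by auto
  have "K < exp (\<epsilon> * \<eta> * u) * (c * tail F u)" using u(2) c by (simp add: divide_less_eq mult_ac)
  also have "\<dots> \<le> exp (\<epsilon> * (\<eta> * u)) * tail H (\<eta> * u)"
    using low[OF u(1)] by (simp add: mult.assoc)
  finally show "\<exists>x. K < exp (\<epsilon> * x) * tail H x" by blast
qed

end

section \<open>Uniform equivalence of conditional tails\<close>

text \<open>Uniformity in \<open>y\<close> is what makes the threshold \<open>x0\<close> the same for every \<open>y\<close>.\<close>

lemma uniform_ratio_limit_bounds:
  fixes T :: "real \<Rightarrow> real" and h :: "'b \<Rightarrow> real" and k :: "'b \<Rightarrow> real \<Rightarrow> real"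
  assumes T: "\<And>x. 0 < T x"
    and sup: "((\<lambda>x. SUP y \<in> S. ereal \<bar>k y x / (h y * T x) - 1\<bar>) \<longlongrightarrow> 0) at_top"
    and "0 < \<delta>"
  shows "\<exists>x0. \<forall>x\<ge>x0. \<forall>y\<in>S. 0 < h y \<longrightarrow>
      (1 - \<delta>) * (h y * T x) < k y x \<and> k y x < (1 + \<delta>) * (h y * T x)"
proof -
  have "\<forall>\<^sub>F x in at_top. (SUP y \<in> S. ereal \<bar>k y x / (h y * T x) - 1\<bar>) < ereal \<delta>"
    using order_tendstoD(2)[OF sup, of "ereal \<delta>"] \<open>0 < \<delta>\<close> by simp
  then obtain x0 where x0: "\<And>x. x0 \<le> x \<Longrightarrow> (SUP y \<in> S. ereal \<bar>k y x / (h y * T x) - 1\<bar>) < ereal \<delta>"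
    unfolding eventually_at_top_linorder by blast
  show ?thesis
  proof (intro exI[of _ x0] allI ballI impI)
    fix x y assume xy: "x0 \<le> x" "y \<in> S" "0 < h y"
    have "ereal \<bar>k y x / (h y * T x) - 1\<bar> < ereal \<delta>"
      using xy by (intro le_less_trans[OF SUP_upper x0]) auto
    then have "\<bar>k y x / (h y * T x) - 1\<bar> < \<delta>" by simp
    then have "1 - \<delta> < k y x / (h y * T x)" "k y x / (h y * T x) < 1 + \<delta>" by linarith+
    moreover have "0 < h y * T x" using xy T by simp
    ultimately show "(1 - \<delta>) * (h y * T x) < k y x \<and> k y x < (1 + \<delta>) * (h y * T x)"
      by (simp only: pos_less_divide_eq pos_divide_less_eq)
  qed
qed

theorem theorem2p5:
  fixes M :: "'a measure" and X Y :: "'a \<Rightarrow> real"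
    and F G H :: "real measure" and \<kappa> :: "real \<Rightarrow> real measure"
  assumes "prob_space M"
    and "X \<in> borel_measurable M" and "Y \<in> borel_measurable M"
    and F: "F = distr M borel X"
    and G: "G = distr M borel Y"
    and H: "H = distr M borel (\<lambda>\<omega>. X \<omega> * Y \<omega>)"
    and "measure_support F = UNIV"
    and "(cdf G \<longlongrightarrow> 0) (at_left 0)" and "cdf G 0 < 1"
    and "regular_cond_distr M X Y \<kappa>"
    and A: "\<forall>c>0. (\<lambda>x. tail G (c * x)) \<in> o[at_top](\<lambda>x. tail H x)"
    and B: "\<exists>h :: real \<Rightarrow> real. (\<forall>y\<ge>0. h y > 0) \<and>
      ((\<lambda>x. SUP y \<in> measure_support G.
          ereal \<bar>measure (\<kappa> y) {x<..} / (h y * \<P>(\<omega> in M. X \<omega> > x)) - 1\<bar>) \<longlongrightarrow> 0) at_top"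
  shows "(F \<in> dominatedly_varying \<longrightarrow> H \<in> dominatedly_varying) \<and>
         (F \<in> dominatedly_varying \<inter> long_tailed \<longrightarrow> H \<in> dominatedly_varying \<inter> long_tailed) \<and>
         (F \<in> consistently_varying \<longrightarrow> H \<in> consistently_varying) \<and>
         (F \<in> heavy_tailed \<longrightarrow> H \<in> heavy_tailed)"
proof -
  interpret prob_space M by fact
  note [measurable] = assms(2,3)
  interpret FD: real_distribution F by (simp add: F)
  interpret GD: real_distribution G by (simp add: G)
  have TF: "tail F u = prob {\<omega> \<in> space M. u < X \<omega>}" for u by (simp add: F tail_distr)
  have F_pos: "0 < tail F u" for u
  proof -
    have "u + 1 \<in> measure_support F" using assms(7) by simp
    then have "0 < emeasure F {u<..}" by (auto simp: measure_support_def)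
    then show ?thesis
      by (simp add: emeasure_greaterThan_eq_tail[OF FD.real_distribution_axioms])
  qed
  have Y_pos: "0 < prob {\<omega> \<in> space M. 0 < Y \<omega>}"
    using assms(9) by (simp add: tail_distr[OF assms(3), symmetric] G[symmetric] tail_def)
  have "measure G {..<0} = 0"
    using tendsto_unique[OF _ GD.cdf_at_left assms(8)] by simp
  then have "AE y in G. \<not> y < 0"
    by (intro AE_I'[of "{..<0}"]) (auto simp: null_sets_def GD.emeasure_eq_measure)
  then have G_nonneg: "AE y in G. 0 \<le> y" by eventually_elim simp
  have G_supp: "AE y in G. y \<in> measure_support G \<and> 0 \<le> y"
    using AE_measure_support[of G] G_nonneg by (simp add: G)
  obtain h where h: "\<And>y. 0 \<le> y \<Longrightarrow> 0 < h y" and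
    sup: "((\<lambda>x. SUP y \<in> measure_support G.
          ereal \<bar>measure (\<kappa> y) {x<..} / (h y * tail F x) - 1\<bar>) \<longlongrightarrow> 0) at_top"
    using B by (auto simp: TF)
  note unif = uniform_ratio_limit_bounds[OF F_pos sup]
  note kp = regular_cond_distr_kernel[OF assms(10)]
  have cond_pos: "0 < measure (\<kappa> y) {u<..}" if y: "y \<in> measure_support G" "0 \<le> y" for y u
  proof -
    interpret k: prob_space "\<kappa> y" by (rule kp)
    have "\<exists>x0. \<forall>x\<ge>x0. (1 - 1 / 2) * (h y * tail F x) < measure (\<kappa> y) {x<..}"
      using unif[of "1 / 2"] y h by auto
    then obtain x0 where x0: "\<And>x. x0 \<le> x \<Longrightarrow> (1 - 1 / 2) * (h y * tail F x) < measure (\<kappa> y) {x<..}"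
      by blast
    have "0 < (1 - 1 / 2) * (h y * tail F (max u x0))" using h y F_pos by simp
    also have "\<dots> < measure (\<kappa> y) {max u x0<..}" by (rule x0) simp
    also have "\<dots> \<le> measure (\<kappa> y) {u<..}" by (intro k.finite_measure_mono) (auto simp: kp)
    finally show ?thesis .
  qed
  interpret P: dependent_product M X Y \<kappa>
    rewrites "distr M borel X = F" and "distr M borel Y = G" and "distr M borel (\<lambda>\<omega>. X \<omega> * Y \<omega>) = H"
  proof -
    show "dependent_product M X Y \<kappa>"
    proof
      show "AE \<omega> in M. 0 \<le> Y \<omega>" by (rule AE_distrD[OF assms(3) G_nonneg[unfolded G]])
      show "AE y in distr M borel Y. \<forall>u. 0 < measure (\<kappa> y) {u<..}"
        using G_supp unfolding G[symmetric] by eventually_elim (use cond_pos in auto)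
      fix R :: real assume R: "1 < R"
      \<comment> \<open>\<open>\<delta>\<close> solves \<open>(1 + \<delta>) / (1 - \<delta>) = R\<close>, the loss from one upper and one lower estimate.\<close>
      define \<delta> where "\<delta> = (R - 1) / (R + 1)"
      have \<delta>: "0 < \<delta>" "\<delta> < 1" "1 + \<delta> = R * (1 - \<delta>)"
        using R by (auto simp: \<delta>_def field_simps)
      obtain x0 where x0: "\<And>x y. x0 \<le> x \<Longrightarrow> y \<in> measure_support G \<Longrightarrow> 0 \<le> y \<Longrightarrow>
          (1 - \<delta>) * (h y * tail F x) < measure (\<kappa> y) {x<..} \<and> measure (\<kappa> y) {x<..} < (1 + \<delta>) * (h y * tail F x)"
        using unif[OF \<delta>(1)] h by blast
      have comparable: "measure (\<kappa> y) {u<..} * tail F v \<le> R * measure (\<kappa> y) {v<..} * tail F u"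
        if y: "y \<in> measure_support G" "0 \<le> y" and uv: "x0 \<le> u" "x0 \<le> v" for y u v
      proof -
        have "measure (\<kappa> y) {u<..} * tail F v \<le> ((1 + \<delta>) * (h y * tail F u)) * tail F v"
          using x0[OF uv(1) y] F_pos[of v] by (intro mult_right_mono) auto
        also have "\<dots> = R * ((1 - \<delta>) * (h y * tail F v)) * tail F u"
          by (simp add: \<delta>(3))
        also have "\<dots> \<le> R * measure (\<kappa> y) {v<..} * tail F u"
          using x0[OF uv(2) y] F_pos[of u] R by (intro mult_right_mono mult_left_mono) auto
        finally show ?thesis .
      qed
      from G_supp have "AE y in G. \<forall>u\<ge>x0. \<forall>v\<ge>x0.
          measure (\<kappa> y) {u<..} * tail F v \<le> R * measure (\<kappa> y) {v<..} * tail F u"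
        by eventually_elim (intro allI impI comparable; simp)
      then show "\<exists>x0. AE y in distr M borel Y. \<forall>u\<ge>x0. \<forall>v\<ge>x0.
          measure (\<kappa> y) {u<..} * tail (distr M borel X) v \<le> R * measure (\<kappa> y) {v<..} * tail (distr M borel X) u"
        unfolding G[symmetric] F[symmetric] by blast
    next
      fix c :: real assume "0 < c"
      then show "(\<lambda>x. tail (distr M borel Y) (c * x)) \<in> o[at_top](\<lambda>x. tail (distr M borel (\<lambda>\<omega>. X \<omega> * Y \<omega>)) x)"
        using A by (simp add: G H)
    qed (use assms F_pos Y_pos in \<open>auto simp: F\<close>)
  qed (simp_all add: F G H)
  show ?thesis
    using P.dominatedly_varying_product P.long_tailed_product P.consistently_varying_product
      P.heavy_tailed_product by blast
qed

end
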